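(* Let $\sigma>0$, $\alpha\in[0,\tfrac12]$ and $\kappa>0$, and let $Z_1,Z_2,\dots$ be i.i.d. standard normal random variables. Put $S_0=0$, $S_n=\sigma\sum_{i=1}^n Z_i-\kappa\sigma n^{\alpha}$ for $n\ge1$ (with $n^0=1$), and $L_N=\max_{0\le j\le N}S_j$. Then $\mathbf{E}[L_N]$ grows on the order of $\sqrt N$ as $N\to\infty$. In particular: (a) for all sufficiently large $N$, $$\mathbf{E}[L_N]\ge \sigma G(\kappa)\sqrt N \ \text{ if } \alpha=\tfrac12,\qquad \mathbf{E}[L_N]\ge\sigma G(0)\sqrt N\ \text{ if }\alpha\in[0,\tfrac12);$$ (b) with $\Theta:=N^{\alpha}/N$, $$\mathbf{E}[L_N]\le \sigma\sqrt N\,\bigl[\phi(\kappa\Theta\sqrt N)+G(\kappa\Theta\sqrt N)\bigr]\le \sigma\sqrt N\,[\phi(0)+G(0)]=2\sigma\phi(0)\sqrt N .$$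
   Context: $\phi$ and $\Phi$ are the standard normal density and distribution functions, $\bar\Phi:=1-\Phi$, and $G(x):=\mathbf{E}[(Z-x)^+]=\phi(x)-x\bar\Phi(x)$ for $Z$ standard normal. "Grows on the order of $\sqrt N$" means that there are constants $0<c_1\le c_2<\infty$ independent of $N$ with $c_1\sqrt N\le \mathbf{E}[L_N]\le c_2\sqrt N$ for all sufficiently large $N$. *)

theory Defs
  imports "HOL-Probability.Probability" "HOL-Real_Asymp.Real_Asymp"
begin

abbreviation std_normal_measure :: "real measure" where
  "std_normal_measure \<equiv> density lborel std_normal_density"

definition std_normal_tail :: "real \<Rightarrow> real" where
  "std_normal_tail x = 1 - cdf std_normal_measure x"

definition normal_loss :: "real \<Rightarrow> real" where
  "normal_loss x = (\<integral>z. max (z - x) 0 \<partial>std_normal_measure)"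

lemma normal_loss_closed_form: "normal_loss x = std_normal_density x - x * std_normal_tail x"
proof -
  interpret N: prob_space std_normal_measure
    by (rule prob_space_normal_density) simp
  have meas [measurable]: "normal_density 0 1 \<in> borel_measurable borel"
    by measurable
  have int1: "integrable lborel (\<lambda>z. z * std_normal_density z)"
    using integrable_std_normal_moment[of 1] by (simp add: mult.commute)
  have int0: "integrable lborel std_normal_density"
    using integrable_std_normal_moment[of 0] by simp
  have si1: "set_integrable lborel {x<..} (\<lambda>z. z * std_normal_density z)"
    unfolding set_integrable_def by (rule integrable_mult_indicator[OF _ int1]) simp
  have si0: "set_integrable lborel {x<..} std_normal_density"
    unfolding set_integrable_def by (rule integrable_mult_indicator[OF _ int0]) simp
  have ein: "einterval (ereal x) \<infinity> = {x<..}"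
    by (auto simp: einterval_def)
  have "(LBINT z=ereal x..\<infinity>. z * std_normal_density z) = 0 - (- std_normal_density x)"
  proof (rule interval_integral_FTC_integrable[where F = "\<lambda>z. - std_normal_density z"])
    show "((\<lambda>z. - std_normal_density z) has_vector_derivative z * std_normal_density z) (at z)" for z
      unfolding has_real_derivative_iff_has_vector_derivative[symmetric] std_normal_density_def
      by (auto intro!: derivative_eq_intros simp: field_simps)
    show "isCont (\<lambda>z. z * std_normal_density z) z" for z
      unfolding std_normal_density_def by (intro continuous_intros) auto
    show "((((\<lambda>z. - std_normal_density z) \<circ> real_of_ereal) \<longlongrightarrow> - std_normal_density x) (at_right (ereal x)))"
      unfolding ereal_tendsto_simps std_normal_density_def
      by (intro tendsto_intros) auto
    have "((\<lambda>z. - std_normal_density z) \<longlongrightarrow> 0) at_top"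
      unfolding std_normal_density_def by real_asymp
    then show "((((\<lambda>z. - std_normal_density z) \<circ> real_of_ereal) \<longlongrightarrow> 0) (at_left \<infinity>))"
      by (simp only: ereal_tendsto_simps)
  qed (use si1 ein in auto)
  then have I1: "(LINT z:{x<..}|lborel. z * std_normal_density z) = std_normal_density x"
    by (simp add: interval_lebesgue_integral_def ein)
  have "N.prob {x<..} = std_normal_tail x"
  proof -
    have "{x<..} = space std_normal_measure - {..x}" by auto
    then show ?thesis
      using N.prob_compl[of "{..x}"] by (simp add: std_normal_tail_def cdf_def)
  qed
  moreover have "N.prob {x<..} = (LINT z:{x<..}|lborel. std_normal_density z)"
  proof -
    have "N.prob {x<..} = (\<integral>z. indicator {x<..} z \<partial>std_normal_measure)"
      by simp
    also have "\<dots> = (\<integral>z. std_normal_density z *\<^sub>R indicator {x<..} z \<partial>lborel)"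
      by (rule integral_density) auto
    finally show ?thesis by (simp add: set_lebesgue_integral_def mult.commute)
  qed
  ultimately have I0: "(LINT z:{x<..}|lborel. std_normal_density z) = std_normal_tail x"
    by simp
  have "normal_loss x = (\<integral>z. std_normal_density z *\<^sub>R max (z - x) 0 \<partial>lborel)"
    unfolding normal_loss_def by (rule integral_density) auto
  also have "\<dots> = (LINT z:{x<..}|lborel. z * std_normal_density z - x * std_normal_density z)"
    unfolding set_lebesgue_integral_def
    by (rule Bochner_Integration.integral_cong) (auto simp: indicator_def algebra_simps max_def)
  also have "\<dots> = (LINT z:{x<..}|lborel. z * std_normal_density z)
      - x * (LINT z:{x<..}|lborel. std_normal_density z)"
    using si0 si1 by (subst set_integral_diff) auto
  finally show ?thesis by (simp add: I0 I1)
qed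

context
  fixes Z :: "nat \<Rightarrow> 'a \<Rightarrow> real" and \<sigma> \<kappa> \<alpha> :: real
begin

text \<open>The case distinction keeps the value at \<open>n = 0\<close> independent of the convention for
  \<open>0 powr \<alpha>\<close>; for \<open>n \<ge> 1\<close> we have \<open>real n powr 0 = 1\<close>.\<close>
definition drifted_walk :: "nat \<Rightarrow> 'a \<Rightarrow> real" where
  "drifted_walk n \<omega> = (if n = 0 then 0 else \<sigma> * (\<Sum>i = 1..n. Z i \<omega>) - \<kappa> * \<sigma> * real n powr \<alpha>)"

definition running_max :: "nat \<Rightarrow> 'a \<Rightarrow> real" where
  "running_max N \<omega> = Max ((\<lambda>j. drifted_walk j \<omega>) ` {0..N})"

end

end

theory Submission
  imports Defs
begin

text \<open>
  Write \<open>W\<^sub>n = Z\<^sub>1 + \<dots> + Z\<^sub>n\<close>. For fixed \<open>N\<close> put \<open>x = \<kappa> N powr (\<alpha> - 1/2)\<close>, which is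
  \<open>\<kappa> \<Theta> \<surd>N\<close>. Since \<open>\<alpha> \<le> 1/2\<close>, the boundary \<open>\<kappa> n powr \<alpha>\<close> lies above \<open>x \<surd>n\<close> for all
  \<open>1 \<le> n \<le> N\<close>, so that \<open>L\<^sub>N \<le> \<sigma> R\<^sub>N\<close> with \<open>R\<^sub>n = max {W\<^sub>j - x \<surd>j | j \<le> n}\<close>. Comparing
  with the chord \<open>x n / \<surd>N\<close> instead would lose too much: for large \<open>N\<close> and \<open>x\<close> the maximum
  relative to this line has expectation of order \<open>\<surd>N / x\<close>, whereas the claimed bound decays
  like \<open>exp (- x\<^sup>2 / 2)\<close> in \<open>x\<close>.

  The maximum \<open>R\<close> grows at time \<open>n\<close> only if \<open>W\<^sub>n > x \<surd>n\<close>, and then, because the square root is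
  concave, by no more than the walk with constant drift \<open>\<nu> = x / (2 \<surd>n)\<close>, the slope of the
  boundary at \<open>n\<close>, exceeds its previous maximum (\<open>peak_increment_le\<close>). The steps of that walk
  are i.i.d., hence exchangeable, and a cycle lemma applies: over the \<open>n\<close> cyclic shifts of a
  sequence with nonnegative total, these last-step gains add up to the total itself
  (\<open>sum_cyclic_record_gain\<close>). The event \<open>W\<^sub>n > x \<surd>n\<close> does not change under shifts, and on it
  the total \<open>W\<^sub>n - \<nu> n\<close> is positive. So the expected gain is
  \<open>E[W\<^sub>n - \<nu> n; W\<^sub>n > x \<surd>n] / n = (\<phi> x + G x) / (2 \<surd>n)\<close>, a one-dimensional Gaussian integral.
  Summing over \<open>n\<close> with \<open>1 / (2 \<surd>n) \<le> \<surd>n - \<surd>(n - 1)\<close> gives part (b).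

  For \<open>\<alpha> = 1/2\<close> the lower bound only needs \<open>L\<^sub>N \<ge> max 0 S\<^sub>N\<close>. For \<open>\<alpha> < 1/2\<close> the last step alone
  falls just short of \<open>\<sigma> G 0 \<surd>N\<close>, so the whole maximum has to be used. Without a boundary
  (\<open>x = 0\<close>) the argument above consists of equalities and yields
  \<open>E[max W\<^sub>j] = \<phi> 0 * (\<Sum>n=1..N. 1 / \<surd>n)\<close>, which is about \<open>2 \<phi> 0 \<surd>N\<close>. That leaves a surplus of
  order \<open>\<surd>N\<close> over the target \<open>\<phi> 0 \<surd>N\<close>, larger than the drift \<open>\<kappa> N powr \<alpha>\<close> in the end.
\<close>

section \<open>A cycle lemma for new maxima\<close>

text \<open>The growth at time \<open>n\<close> of the running maximum of the walk with steps \<open>y\<close>.\<close>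
definition record_gain :: "nat \<Rightarrow> (nat \<Rightarrow> real) \<Rightarrow> real" where
  "record_gain n y = max 0 (sum y {..<n} - Max ((\<lambda>k. sum y {..<k}) ` {..<n}))"

lemma sum_periodic_shift:
  fixes y :: "nat \<Rightarrow> real"
  shows "(\<Sum>i<k + n. y (i mod n)) = (\<Sum>i<k. y (i mod n)) + sum y {..<n}"
proof (induction k)
  case 0
  show ?case by simp
next
  case (Suc k)
  then show ?case by simp
qed

text \<open>
  Extend \<open>y\<close> periodically and slide a window of \<open>n\<close> consecutive partial sums along the extension.
  Since the total over a period is nonnegative, the value that leaves the window is never above
  the one that enters, so the maximum over the window can only be raised by the entering value.
  The amount by which it rises is the gain of the corresponding shift, and over one period the
  window maximum rises by exactly the total.
\<close>
lemma sum_cyclic_record_gain: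
  assumes n: "1 \<le> n" and nonneg: "0 \<le> sum y {..<n}"
  shows "(\<Sum>r<n. record_gain n (\<lambda>i. y ((r + i) mod n))) = sum y {..<n}"
proof -
  define T where "T k = (\<Sum>i<k. y (i mod n))" for k
  define P where "P r = Max (T ` {r..<r + n})" for r
  have T_add: "T (k + n) = T k + sum y {..<n}" for k
    unfolding T_def by (rule sum_periodic_shift)
  have T_shift: "(\<Sum>i<k. y ((r + i) mod n)) = T (r + k) - T r" for r k
    by (induction k) (simp_all add: T_def)
  have P_Suc: "P (Suc r) = max (P r) (T (r + n))" for r
  proof -
    have eq: "insert (T r) (T ` {Suc r..<Suc r + n}) = insert (T (r + n)) (T ` {r..<r + n})"
    proof -
      have "insert r {Suc r..<Suc r + n} = insert (r + n) {r..<r + n}" by auto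
      then show ?thesis by (metis image_insert)
    qed
    have le: "T r \<le> P (Suc r)"
    proof -
      have "T r \<le> T (r + n)" using nonneg by (simp add: T_add)
      also have "T (r + n) \<le> P (Suc r)" unfolding P_def using n by (intro Max_ge) auto
      finally show ?thesis .
    qed
    have "P (Suc r) = Max (insert (T r) (T ` {Suc r..<Suc r + n}))"
      using le n unfolding P_def by (subst Max_insert) auto
    also have "\<dots> = max (T (r + n)) (P r)"
      unfolding eq P_def using n by (subst Max_insert) auto
    finally show ?thesis by (simp add: max.commute)
  qed
  have gain: "record_gain n (\<lambda>i. y ((r + i) mod n)) = P (Suc r) - P r" for r
  proof -
    have "Max ((\<lambda>k. T (r + k) - T r) ` {..<n}) = Max ((\<lambda>x. x - T r) ` (T ` {r..<r + n}))"
    proof -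
      have "{r..<r + n} = (\<lambda>k. r + k) ` {..<n}"
        by (simp add: lessThan_atLeast0 image_add_atLeastLessThan add.commute)
      then show ?thesis by (simp add: image_image)
    qed
    also have "\<dots> = P r - T r"
      unfolding P_def using n
      by (intro mono_Max_commute[symmetric]) (auto intro!: monoI)
    finally show ?thesis
      by (simp add: record_gain_def T_shift P_Suc max_def)
  qed
  have "P n = P 0 + sum y {..<n}"
  proof -
    have "{n..<n + n} = (\<lambda>k. k + n) ` {0..<n}" by simp
    then have "T ` {n..<n + n} = (\<lambda>x. x + sum y {..<n}) ` (T ` {0..<n})"
      by (simp only: image_image T_add)
    then show ?thesis
      unfolding P_def using n
      by (simp, intro mono_Max_commute[symmetric]) (auto intro!: monoI)
  qed
  moreover have "(\<Sum>r<n. P (Suc r) - P r) = P n - P 0"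
    by (rule sum_lessThan_telescope)
  ultimately show ?thesis by (simp add: gain)
qed

section \<open>Exchangeability\<close>

text \<open>
  Both families have the same joint law, the product of copies of \<open>D\<close>, because a product measure
  projects to a product measure under an injective choice of coordinates.
\<close>
lemma (in prob_space) expectation_iid_reindex:
  fixes X :: "'i \<Rightarrow> 'a \<Rightarrow> real" and g :: "('j \<Rightarrow> real) \<Rightarrow> real"
  assumes indep: "indep_vars (\<lambda>_. borel) X I" and law: "\<And>i. i \<in> I \<Longrightarrow> distr M borel (X i) = D"
    and f: "inj_on f J" "f ` J \<subseteq> I" and h: "inj_on h J" "h ` J \<subseteq> I" and "J \<noteq> {}"
    and g: "g \<in> borel_measurable (\<Pi>\<^sub>M j\<in>J. borel)"
  shows "expectation (\<lambda>\<omega>. g (\<lambda>j\<in>J. X (f j) \<omega>)) = expectation (\<lambda>\<omega>. g (\<lambda>j\<in>J. X (h j) \<omega>))"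
proof -
  have rv: "random_variable borel (X i)" if "i \<in> I" for i
    using indep that by (auto simp: indep_vars_def2)
  have "I \<noteq> {}" using f \<open>J \<noteq> {}\<close> by auto
  have D: "prob_space D" "sets D = sets borel"
    using law rv \<open>I \<noteq> {}\<close> by (metis all_not_in_conv prob_space_distr, metis all_not_in_conv sets_distr)
  have joint: "distr M (\<Pi>\<^sub>M i\<in>I. borel) (\<lambda>\<omega>. \<lambda>i\<in>I. X i \<omega>) = (\<Pi>\<^sub>M i\<in>I. D)"
    using indep_vars_iff_distr_eq_PiM'[OF \<open>I \<noteq> {}\<close> rv] indep law
    by (auto intro: PiM_cong)
  have "expectation (\<lambda>\<omega>. g (\<lambda>j\<in>J. X (k j) \<omega>)) = (\<integral>v. g v \<partial>(\<Pi>\<^sub>M j\<in>J. D))"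
    if k: "inj_on k J" "k ` J \<subseteq> I" for k
  proof -
    have sets_J: "sets (\<Pi>\<^sub>M j\<in>J. D) = sets (\<Pi>\<^sub>M j\<in>J. borel)"
      using D by (intro sets_PiM_cong) auto
    have sets_I: "sets (\<Pi>\<^sub>M j\<in>I. D) = sets (\<Pi>\<^sub>M j\<in>I. borel)"
      using D by (intro sets_PiM_cong) auto
    have gD: "g \<in> borel_measurable (\<Pi>\<^sub>M j\<in>J. D)"
      using g by (simp cong: measurable_cong_sets add: sets_J)
    have proj: "(\<lambda>v. \<lambda>j\<in>J. v (k j)) \<in> measurable (\<Pi>\<^sub>M j\<in>I. D) (\<Pi>\<^sub>M j\<in>J. D)"
      using k by (intro measurable_restrict measurable_component_singleton) auto
    have proj': "(\<lambda>v. g (\<lambda>j\<in>J. v (k j))) \<in> borel_measurable (\<Pi>\<^sub>M i\<in>I. borel)"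
      using measurable_compose[OF proj gD] by (simp cong: measurable_cong_sets add: sets_I)
    have "(\<integral>v. g v \<partial>(\<Pi>\<^sub>M j\<in>J. D)) = (\<integral>v. g v \<partial>distr (\<Pi>\<^sub>M i\<in>I. D) (\<Pi>\<^sub>M j\<in>J. D) (\<lambda>v. \<lambda>j\<in>J. v (k j)))"
      using distr_PiM_reindex[of I "\<lambda>_. D" k J] D k by (auto simp: image_subset_iff)
    also have "\<dots> = (\<integral>v. g (\<lambda>j\<in>J. v (k j)) \<partial>(\<Pi>\<^sub>M i\<in>I. D))"
      by (rule integral_distr[OF proj gD])
    also have "\<dots> = expectation (\<lambda>\<omega>. g (\<lambda>j\<in>J. (\<lambda>i\<in>I. X i \<omega>) (k j)))"
      unfolding joint[symmetric]
      by (rule integral_distr[OF _ proj']) (auto intro!: measurable_restrict rv)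
    also have "\<dots> = expectation (\<lambda>\<omega>. g (\<lambda>j\<in>J. X (k j) \<omega>))"
    proof -
      have "(\<lambda>j\<in>J. (\<lambda>i\<in>I. X i \<omega>) (k j)) = (\<lambda>j\<in>J. X (k j) \<omega>)" for \<omega>
        using k by (auto simp: restrict_def fun_eq_iff)
      then show ?thesis by simp
    qed
    finally show ?thesis by simp
  qed
  from this[OF f] this[OF h] show ?thesis by simp
qed


lemma sum_cyclic_shift:
  fixes y :: "nat \<Rightarrow> real"
  assumes "1 \<le> n"
  shows "(\<Sum>i<n. y ((r + i) mod n)) = sum y {..<n}"
proof -
  have "(\<Sum>i<k. y ((r + i) mod n)) = (\<Sum>i<r + k. y (i mod n)) - (\<Sum>i<r. y (i mod n))" for k
    by (induction k) simp_all
  then show ?thesis by (simp add: sum_periodic_shift)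
qed

lemma inj_on_cyclic_shift: "inj_on (\<lambda>i. (r + i) mod n) {..<n::nat}"
proof (rule linorder_inj_onI)
  fix i j assume "i < j" "i \<in> {..<n}" "j \<in> {..<n}"
  show "(r + i) mod n \<noteq> (r + j) mod n"
  proof
    assume "(r + i) mod n = (r + j) mod n"
    then have "n dvd (r + j) - (r + i)"
      using \<open>i < j\<close> by (metis mod_eq_dvd_iff_nat add_le_mono1 add.commute less_imp_le)
    then show False using \<open>i < j\<close> \<open>j \<in> _\<close> by (auto dest: dvd_imp_le)
  qed
qed auto

lemma record_gain_nonneg: "0 \<le> record_gain n y"
  by (simp add: record_gain_def)

lemma record_gain_le: "1 \<le> n \<Longrightarrow> record_gain n y \<le> max 0 (sum y {..<n})"
proof -
  assume "1 \<le> n"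
  then have "(\<Sum>i<(0::nat). y i) \<le> Max ((\<lambda>k. sum y {..<k}) ` {..<n})"
    by (intro Max_ge imageI) auto
  then show ?thesis by (simp add: record_gain_def)
qed

lemma record_gain_cong: "(\<And>i. i < n \<Longrightarrow> y i = y' i) \<Longrightarrow> record_gain n y = record_gain n y'"
proof -
  assume *: "\<And>i. i < n \<Longrightarrow> y i = y' i"
  then have "(\<lambda>k. sum y {..<k}) ` {..<n} = (\<lambda>k. sum y' {..<k}) ` {..<n}"
    by (intro image_cong sum.cong) auto
  moreover have "sum y {..<n} = sum y' {..<n}" using * by simp
  ultimately show ?thesis by (simp add: record_gain_def)
qed

lemma measurable_record_gain [measurable (raw)]:
  assumes "\<And>i. i < n \<Longrightarrow> (\<lambda>\<omega>. Y i \<omega>) \<in> borel_measurable M"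
  shows "(\<lambda>\<omega>. record_gain n (\<lambda>i. Y i \<omega>)) \<in> borel_measurable M"
  unfolding record_gain_def using assms
  by (intro borel_measurable_max borel_measurable_diff borel_measurable_sum borel_measurable_Max) auto

text \<open>
  By exchangeability the expectation on the left is unchanged when the steps are shifted
  cyclically, so it is the average over all shifts, and the cycle lemma evaluates that average
  pointwise. The condition \<open>0 \<le> c\<close> makes the total nonnegative on the event in question.
\<close>
lemma (in prob_space) expectation_record_gain:
  fixes Y :: "nat \<Rightarrow> 'a \<Rightarrow> real"
  assumes indep: "indep_vars (\<lambda>_. borel) Y {1..}"
    and law: "\<And>i. 1 \<le> i \<Longrightarrow> distr M borel (Y i) = D"
    and int: "\<And>i. 1 \<le> i \<Longrightarrow> integrable M (Y i)"
    and n: "1 \<le> n" and c: "0 \<le> c"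
  shows "expectation (\<lambda>\<omega>. indicator {c<..} (\<Sum>i=1..n. Y i \<omega>) * record_gain n (\<lambda>i. Y (Suc i) \<omega>))
    = expectation (\<lambda>\<omega>. indicator {c<..} (\<Sum>i=1..n. Y i \<omega>) * (\<Sum>i=1..n. Y i \<omega>)) / n"
proof -
  define g where "g y = indicator {c<..} (sum y {..<n}) * record_gain n y" for y :: "nat \<Rightarrow> real"
  (* Walk steps are numbered from 1, entries of a sequence from 0. *)
  define f where "f r i = Suc ((r + i) mod n)" for r i :: nat
  have inj: "inj_on (f r) {..<n}" for r
    using inj_on_cyclic_shift[of r n] unfolding inj_on_def f_def by blast
  have g_restrict: "g (\<lambda>i\<in>{..<n}. y i) = g y" for y
  proof -
    have "record_gain n (\<lambda>i\<in>{..<n}. y i) = record_gain n y" by (rule record_gain_cong) simp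
    then show ?thesis by (simp add: g_def)
  qed
  have g_meas: "g \<in> borel_measurable (\<Pi>\<^sub>M i\<in>{..<n}. borel)"
    unfolding g_def[abs_def]
    by (intro borel_measurable_times measurable_record_gain borel_measurable_indicator'
        borel_measurable_sum measurable_component_singleton) auto
  have S: "(\<Sum>i<n. Y (f r i) \<omega>) = (\<Sum>i=1..n. Y i \<omega>)" for r \<omega>
  proof -
    have "(\<Sum>i<n. Y (f r i) \<omega>) = (\<Sum>i<n. Y (Suc i) \<omega>)"
      unfolding f_def using sum_cyclic_shift[OF n, of "\<lambda>i. Y (Suc i) \<omega>" r] by simp
    also have "\<dots> = (\<Sum>i=1..n. Y i \<omega>)"
      by (simp add: sum.atLeast1_atMost_eq)
    finally show ?thesis .
  qed
  have shift: "expectation (\<lambda>\<omega>. g (\<lambda>i. Y (f r i) \<omega>)) = expectation (\<lambda>\<omega>. g (\<lambda>i. Y (Suc i) \<omega>))" for r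
  proof -
    have "expectation (\<lambda>\<omega>. g (\<lambda>i\<in>{..<n}. Y (f r i) \<omega>)) = expectation (\<lambda>\<omega>. g (\<lambda>i\<in>{..<n}. Y (Suc i) \<omega>))"
      using n by (intro expectation_iid_reindex[OF indep law _ _ _ _ _ g_meas] inj)
        (auto simp: f_def lessThan_empty_iff)
    then show ?thesis by (simp add: g_restrict)
  qed
  have meas: "Y (f r i) \<in> borel_measurable M" for r i
    using int[of "f r i"] by (simp add: f_def)
  have g_int: "integrable M (\<lambda>\<omega>. g (\<lambda>i. Y (f r i) \<omega>))" for r
  proof (rule Bochner_Integration.integrable_bound)
    show "integrable M (\<lambda>\<omega>. \<Sum>i<n. Y (f r i) \<omega>)"
      using int by (auto simp: f_def)
    show "(\<lambda>\<omega>. g (\<lambda>i. Y (f r i) \<omega>)) \<in> borel_measurable M"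
      unfolding g_def using meas
      by (intro borel_measurable_times measurable_record_gain borel_measurable_indicator'
          borel_measurable_sum) auto
    have "norm (g y) \<le> norm (sum y {..<n})" for y
      using record_gain_le[OF n, of y] record_gain_nonneg[of n y]
      by (cases "c < sum y {..<n}") (simp_all add: g_def)
    then show "AE \<omega> in M. norm (g (\<lambda>i. Y (f r i) \<omega>)) \<le> norm (\<Sum>i<n. Y (f r i) \<omega>)"
      by (intro AE_I2)
  qed
  have cyclic: "(\<Sum>r<n. g (\<lambda>i. Y (f r i) \<omega>)) = indicator {c<..} (\<Sum>i=1..n. Y i \<omega>) * (\<Sum>i=1..n. Y i \<omega>)" for \<omega>
  proof (cases "c < (\<Sum>i=1..n. Y i \<omega>)")
    case True
    then have "0 \<le> (\<Sum>i<n. Y (Suc i) \<omega>)"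
      using c by (simp add: sum.atLeast1_atMost_eq)
    from sum_cyclic_record_gain[OF n this] True show ?thesis
      by (simp add: g_def S) (simp add: f_def sum.atLeast1_atMost_eq)
  next
    case False
    then show ?thesis by (simp add: g_def S)
  qed
  have "n * expectation (\<lambda>\<omega>. g (\<lambda>i. Y (Suc i) \<omega>)) = (\<Sum>r<n. expectation (\<lambda>\<omega>. g (\<lambda>i. Y (f r i) \<omega>)))"
    by (simp add: shift)
  also have "\<dots> = expectation (\<lambda>\<omega>. \<Sum>r<n. g (\<lambda>i. Y (f r i) \<omega>))"
    using g_int by simp
  finally have "expectation (\<lambda>\<omega>. g (\<lambda>i. Y (Suc i) \<omega>))
      = expectation (\<lambda>\<omega>. indicator {c<..} (\<Sum>i=1..n. Y i \<omega>) * (\<Sum>i=1..n. Y i \<omega>)) / n"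
    using n by (simp add: cyclic nonzero_eq_divide_eq mult.commute)
  then show ?thesis by (simp add: g_def sum.atLeast1_atMost_eq)
qed


section \<open>Square roots\<close>

text \<open>The chord of the square root from \<open>k\<close> to \<open>n\<close> is at least as steep as the tangent at \<open>n\<close>.\<close>
lemma sqrt_increment_ge:
  fixes n k :: real
  assumes "0 < n" "0 \<le> k" "k \<le> n"
  shows "(n - k) / (2 * sqrt n) \<le> sqrt n - sqrt k"
proof -
  have "n - k = (sqrt n - sqrt k) * (sqrt n + sqrt k)"
    using assms by (simp add: algebra_simps)
  also have "\<dots> \<le> (sqrt n - sqrt k) * (2 * sqrt n)"
    using assms by (intro mult_left_mono) auto
  finally show ?thesis using assms by (simp add: divide_le_eq)
qed

lemma sum_inverse_sqrt_le: "(\<Sum>n=1..N. 1 / (2 * sqrt (real n))) \<le> sqrt (real N)"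
proof (induction N)
  case (Suc N)
  have "1 / (2 * sqrt (real (Suc N))) \<le> sqrt (real (Suc N)) - sqrt (real N)"
    using sqrt_increment_ge[of "real (Suc N)" "real N"] by simp
  then show ?case using Suc by simp
qed simp

lemma sum_inverse_sqrt_ge: "2 * sqrt (real N + 1) - 2 \<le> (\<Sum>n=1..N. 1 / sqrt (real n))"
proof (induction N)
  case (Suc N)
  define a b where "a = sqrt (real N + 1)" and "b = sqrt (real N + 2)"
  have ab: "0 < a" "a \<le> b" "b\<^sup>2 = a\<^sup>2 + 1" by (auto simp: a_def b_def)
  have "2 * (b - a) * a \<le> (b - a) * (b + a)"
    using mult_left_mono[of "2 * a" "b + a" "b - a"] ab by (simp add: mult_ac)
  also have "\<dots> = 1" using ab(3) by (simp add: algebra_simps power2_eq_square)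
  finally have "2 * (b - a) \<le> 1 / a" using ab by (simp add: pos_le_divide_eq)
  then show ?case using Suc by (simp add: a_def b_def add.commute)
qed simp

section \<open>Gaussian integrals\<close>

lemma prob_space_std_normal: "prob_space std_normal_measure"
  by (rule prob_space_normal_density) simp

lemma integrable_std_normal_excess: "integrable std_normal_measure (\<lambda>z. max (z - x) 0)"
proof -
  interpret N: prob_space std_normal_measure by (rule prob_space_std_normal)
  have "integrable std_normal_measure (\<lambda>z. z)"
    using integrable_std_normal_moment[of 1]
    by (subst integrable_density) auto
  then show ?thesis by simp
qed

lemma std_normal_tail_eq: "std_normal_tail x = measure std_normal_measure {x<..}"
proof -
  interpret N: prob_space std_normal_measure by (rule prob_space_std_normal)
  have "{x<..} = space std_normal_measure - {..x}" by auto
  then show ?thesis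
    using N.prob_compl[of "{..x}"] by (simp add: std_normal_tail_def cdf_def)
qed

text \<open>
  The integrand is \<open>(u - x)\<^sup>+\<close> plus \<open>x / 2\<close> on \<open>u > x\<close>, so the integral is \<open>G x\<close> plus \<open>x / 2\<close> times
  the tail, and the closed form of \<open>G\<close> says that \<open>x\<close> times the tail is \<open>\<phi> x - G x\<close>. The shift by
  half of \<open>x\<close> reflects that the tangent of \<open>x \<surd>t\<close> at \<open>n\<close> rises by \<open>x \<surd>n / 2\<close> over \<open>{0..n}\<close>.
\<close>
lemma std_normal_truncated_mean:
  "(\<integral>u. indicator {x<..} u * (u - x / 2) \<partial>std_normal_measure) = (std_normal_density x + normal_loss x) / 2"
proof -
  interpret N: prob_space std_normal_measure by (rule prob_space_std_normal)
  have "(\<integral>u. indicator {x<..} u * (u - x / 2) \<partial>std_normal_measure)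
      = (\<integral>u. max (u - x) 0 + x / 2 * indicator {x<..} u \<partial>std_normal_measure)"
    by (intro Bochner_Integration.integral_cong) (auto simp: indicator_def)
  also have "\<dots> = normal_loss x + x / 2 * std_normal_tail x"
  proof -
    have "integrable std_normal_measure (\<lambda>u. x / 2 * indicator {x<..} u)"
      by (intro integrable_mult_right integrable_real_indicator) (auto simp: N.emeasure_eq_measure)
    then show ?thesis
      by (subst Bochner_Integration.integral_add[OF integrable_std_normal_excess])
        (simp_all add: normal_loss_def std_normal_tail_eq)
  qed
  also have "\<dots> = (std_normal_density x + normal_loss x) / 2"
    by (simp add: normal_loss_closed_form)
  finally show ?thesis .
qed

lemma normal_loss_antimono: "x \<le> y \<Longrightarrow> normal_loss y \<le> normal_loss x"
  unfolding normal_loss_def by (intro integral_mono integrable_std_normal_excess) auto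

lemma normal_loss_nonneg: "0 \<le> normal_loss x"
  unfolding normal_loss_def by (intro integral_nonneg_AE) auto

lemma normal_loss_0: "normal_loss 0 = std_normal_density 0"
  by (simp add: normal_loss_closed_form)

lemma std_normal_density_le_0: "std_normal_density x \<le> std_normal_density 0"
  by (simp add: std_normal_density_def divide_right_mono)

lemma normal_loss_pos: "0 < normal_loss x"
proof (rule ccontr)
  assume "\<not> 0 < normal_loss x"
  then have "(\<integral>z. max (z - x) 0 \<partial>std_normal_measure) = 0"
    using normal_loss_nonneg[of x] unfolding normal_loss_def by linarith
  then have "AE z in std_normal_measure. max (z - x) 0 = 0"
    by (subst (asm) integral_nonneg_eq_0_iff_AE[OF integrable_std_normal_excess]) auto
  then have "AE z in lborel. z \<le> x"
    by (subst (asm) AE_density) (auto simp: max_def normal_density_pos elim!: eventually_mono split: if_splits)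
  then have "AE z in lborel. z \<notin> {x<..<x + 1}" by eventually_elim auto
  then have "emeasure lborel {x<..<x + 1} = 0"
    by (subst (asm) AE_iff_measurable[of "{x<..<x + 1}"]) auto
  then show False by simp
qed

section \<open>The maximum of a Gaussian walk below a square root boundary\<close>

locale std_normal_sequence = prob_space +
  fixes Z :: "nat \<Rightarrow> 'a \<Rightarrow> real"
  assumes indep: "indep_vars (\<lambda>_. borel) Z {1..}"
    and std_normal: "\<And>i. 1 \<le> i \<Longrightarrow> distributed M lborel (Z i) std_normal_density"
begin

lemma integrable_Z: "1 \<le> i \<Longrightarrow> integrable M (Z i)"
  using distributed_integrable[OF std_normal[of i], of "\<lambda>x. x"] integrable_std_normal_moment[of 1]
  by simp

lemma law_shifted_Z:
  assumes "1 \<le> i"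
  shows "distr M borel (\<lambda>\<omega>. Z i \<omega> - c) = distr std_normal_measure borel (\<lambda>z. z - c)"
proof -
  have "distr std_normal_measure borel (\<lambda>z. z - c) = distr (distr M lborel (Z i)) borel (\<lambda>z. z - c)"
    using distributed_distr_eq_density[OF std_normal[OF assms]] by simp
  also have "\<dots> = distr M borel ((\<lambda>z. z - c) \<circ> Z i)"
    using distributed_measurable[OF std_normal[OF assms]] by (intro distr_distr) auto
  finally show ?thesis by (simp add: comp_def)
qed

lemma expectation_normalized_sum:
  assumes n: "1 \<le> n" and g: "(g :: real \<Rightarrow> real) \<in> borel_measurable borel"
  shows "expectation (\<lambda>\<omega>. g ((\<Sum>i=1..n. Z i \<omega>) / sqrt n)) = (\<integral>u. g u \<partial>std_normal_measure)"
proof -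
  have "distributed M lborel (\<lambda>\<omega>. \<Sum>i=1..n. Z i \<omega>)
      (normal_density (\<Sum>i=1..n. 0) (sqrt (\<Sum>i=1..n. 1\<^sup>2)))"
    using n std_normal by (intro sum_indep_normal indep_vars_subset[OF indep]) auto
  then have "distributed M lborel (\<lambda>\<omega>. \<Sum>i=1..n. Z i \<omega>) (normal_density 0 (sqrt n))"
    by simp
  then have U: "distributed M lborel (\<lambda>\<omega>. (\<Sum>i=1..n. Z i \<omega>) / sqrt n) std_normal_density"
    using n by (subst (asm) normal_standard_normal_convert) auto
  have "integral\<^sup>L (distr M lborel (\<lambda>\<omega>. (\<Sum>i=1..n. Z i \<omega>) / sqrt n)) g
      = expectation (\<lambda>\<omega>. g ((\<Sum>i=1..n. Z i \<omega>) / sqrt n))"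
    using g by (intro integral_distr[OF distributed_measurable[OF U]]) simp
  then show ?thesis by (simp only: distributed_distr_eq_density[OF U])
qed


definition walk :: "nat \<Rightarrow> 'a \<Rightarrow> real" where
  "walk n \<omega> = (\<Sum>i=1..n. Z i \<omega>)"

definition peak :: "real \<Rightarrow> nat \<Rightarrow> 'a \<Rightarrow> real" where
  "peak x N \<omega> = Max ((\<lambda>j. walk j \<omega> - x * sqrt j) ` {..N})"

lemma integrable_walk: "integrable M (walk n)"
  unfolding walk_def[abs_def] by (intro Bochner_Integration.integrable_sum integrable_Z) auto

lemma integrable_peak: "integrable M (peak x N)"
  unfolding peak_def[abs_def]
  by (intro integrable_MAX Bochner_Integration.integrable_diff integrable_walk) auto

lemma peak_0: "peak x 0 \<omega> = 0"
  by (simp add: peak_def walk_def)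

lemma peak_Suc: "peak x (Suc N) \<omega> = max (walk (Suc N) \<omega> - x * sqrt (Suc N)) (peak x N \<omega>)"
  unfolding peak_def atMost_Suc image_insert by (rule Max_insert) auto

lemma peak_ge: "k \<le> N \<Longrightarrow> walk k \<omega> - x * sqrt k \<le> peak x N \<omega>"
  unfolding peak_def by (intro Max_ge) auto

lemma peak_nonneg: "0 \<le> peak x N \<omega>"
  using peak_ge[of 0 N \<omega> x] by (simp add: walk_def)

lemma record_gain_walk:
  "record_gain n (\<lambda>i. Z (Suc i) \<omega> - \<nu>)
    = max 0 (walk n \<omega> - \<nu> * n - Max ((\<lambda>k. walk k \<omega> - \<nu> * k) ` {..<n}))"
proof -
  have "(\<Sum>i<k. Z (Suc i) \<omega> - \<nu>) = walk k \<omega> - \<nu> * k" for k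
    by (simp add: walk_def sum.atLeast1_atMost_eq sum_subtractf)
  then show ?thesis by (simp add: record_gain_def)
qed

text \<open>
  A bound for the growth of \<open>peak x\<close> at time \<open>n\<close>: the curved boundary is replaced by its tangent
  direction at \<open>n\<close>, which makes the steps i.i.d., while the condition that \<open>walk n\<close> lies above the
  curved boundary itself is kept.
\<close>
definition ladder_increment :: "real \<Rightarrow> nat \<Rightarrow> 'a \<Rightarrow> real" where
  "ladder_increment x n \<omega> =
    indicator {x * sqrt n <..} (walk n \<omega>) * record_gain n (\<lambda>i. Z (Suc i) \<omega> - x / (2 * sqrt n))"

text \<open>
  Going back from \<open>n\<close> to an earlier \<open>k\<close>, the boundary drops by at least what the tangent at \<open>n\<close>
  drops. If instead \<open>walk n\<close> is not above the boundary, there is no growth, because the value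
  \<open>0\<close> at time \<open>0\<close> already counts.
\<close>
lemma peak_increment_le:
  assumes "0 \<le> x"
  shows "peak x (Suc m) \<omega> - peak x m \<omega> \<le> ladder_increment x (Suc m) \<omega>"
proof (cases "x * sqrt (Suc m) < walk (Suc m) \<omega>")
  case True
  define \<nu> where "\<nu> = x / (2 * sqrt (Suc m))"
  let ?T = "\<lambda>k. walk k \<omega> - \<nu> * real k"
  have "Max (?T ` {..<Suc m}) \<in> ?T ` {..<Suc m}" by (intro Max_in) auto
  then obtain k where k: "k \<le> m" "Max (?T ` {..<Suc m}) = ?T k"
    by (auto simp: less_Suc_eq_le)
  have "\<nu> * (real (Suc m) - real k) \<le> x * (sqrt (Suc m) - sqrt k)"
    using mult_left_mono[OF sqrt_increment_ge[of "real (Suc m)" "real k"] assms] k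
    by (simp add: \<nu>_def)
  then have "walk (Suc m) \<omega> - x * sqrt (Suc m) - peak x m \<omega> \<le> ?T (Suc m) - ?T k"
    using peak_ge[OF k(1), of \<omega> x] by (simp only: right_diff_distrib)
  then show ?thesis
    using True k by (simp only: ladder_increment_def record_gain_walk peak_Suc \<nu>_def[symmetric]) auto
next
  case False
  then show ?thesis
    using peak_nonneg[of x m \<omega>] by (simp add: ladder_increment_def peak_Suc)
qed

lemma peak_increment_driftless:
  "peak 0 (Suc m) \<omega> - peak 0 m \<omega> = ladder_increment 0 (Suc m) \<omega>"
proof -
  have "record_gain (Suc m) (\<lambda>i. Z (Suc i) \<omega>) = max 0 (walk (Suc m) \<omega> - peak 0 m \<omega>)"
    using record_gain_walk[of "Suc m" \<omega> 0] by (simp add: peak_def lessThan_Suc_atMost)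
  then show ?thesis
    using peak_nonneg[of 0 m \<omega>] by (auto simp: ladder_increment_def peak_Suc indicator_def)
qed

lemma expectation_ladder_increment:
  assumes x: "0 \<le> x" and n: "1 \<le> n"
  shows "expectation (ladder_increment x n) = (std_normal_density x + normal_loss x) / (2 * sqrt n)"
proof -
  define \<nu> where "\<nu> = x / (2 * sqrt n)"
  define Y where "Y i \<omega> = Z i \<omega> - \<nu>" for i \<omega>
  have indep_Y: "indep_vars (\<lambda>_. borel) Y {1..}"
    unfolding Y_def[abs_def] by (rule indep_vars_compose2[OF indep]) simp
  have sqn: "\<nu> * n = x * sqrt n / 2"
    using n by (simp add: \<nu>_def field_simps)
  have S: "(\<Sum>i=1..n. Y i \<omega>) = walk n \<omega> - x * sqrt n / 2" for \<omega>
    by (simp add: Y_def walk_def sum_subtractf sqn[symmetric])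
  have ind: "indicator {x * sqrt n / 2<..} (walk n \<omega> - x * sqrt n / 2) = (indicator {x * sqrt n<..} (walk n \<omega>) :: real)" for \<omega>
    by (auto simp: indicator_def)
  have "expectation (ladder_increment x n)
      = expectation (\<lambda>\<omega>. indicator {x * sqrt n / 2<..} (\<Sum>i=1..n. Y i \<omega>) * record_gain n (\<lambda>i. Y (Suc i) \<omega>))"
    unfolding S ind ladder_increment_def[abs_def] by (simp add: Y_def \<nu>_def)
  also have "\<dots> = expectation (\<lambda>\<omega>. indicator {x * sqrt n / 2<..} (\<Sum>i=1..n. Y i \<omega>) * (\<Sum>i=1..n. Y i \<omega>)) / n"
    using x n by (intro expectation_record_gain[OF indep_Y])
      (auto simp: Y_def[abs_def] law_shifted_Z integrable_Z)
  also have "\<dots> = expectation (\<lambda>\<omega>. sqrt n * (indicator {x<..} ((\<Sum>i=1..n. Z i \<omega>) / sqrt n)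
      * ((\<Sum>i=1..n. Z i \<omega>) / sqrt n - x / 2))) / n"
    unfolding S ind using n
    by (intro arg_cong2[where f = "(/)"] Bochner_Integration.integral_cong refl)
      (auto simp: indicator_def walk_def field_simps)
  also have "\<dots> = (\<integral>u. sqrt n * (indicator {x<..} u * (u - x / 2)) \<partial>std_normal_measure) / n"
    by (subst expectation_normalized_sum[OF n, of "\<lambda>u. sqrt n * (indicator {x<..} u * (u - x / 2))"]) auto
  also have "\<dots> = sqrt n * ((std_normal_density x + normal_loss x) / 2) / n"
    by (simp add: std_normal_truncated_mean)
  also have "\<dots> = sqrt n / n * ((std_normal_density x + normal_loss x) / 2)"
    by simp
  also have "\<dots> = (std_normal_density x + normal_loss x) / (2 * sqrt n)"
    unfolding sqrt_divide_self_eq[OF of_nat_0_le_iff] using n by (simp add: field_simps)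
  finally show ?thesis .
qed

lemma integrable_ladder_increment: "1 \<le> n \<Longrightarrow> integrable M (ladder_increment x n)"
proof (rule Bochner_Integration.integrable_bound)
  assume n: "1 \<le> n"
  show "integrable M (\<lambda>\<omega>. walk n \<omega> - x / (2 * sqrt n) * n)"
    using integrable_walk by simp
  show "ladder_increment x n \<in> borel_measurable M"
    unfolding ladder_increment_def[abs_def]
    using integrable_walk[of n] integrable_Z
    by (intro borel_measurable_times measurable_record_gain borel_measurable_indicator'
        borel_measurable_diff) auto
  have sum: "(\<Sum>i<n. Z (Suc i) \<omega> - x / (2 * sqrt n)) = walk n \<omega> - x / (2 * sqrt n) * n" for \<omega>
    by (simp add: walk_def sum.atLeast1_atMost_eq sum_subtractf)
  have "norm (ladder_increment x n \<omega>) \<le> norm (walk n \<omega> - x / (2 * sqrt n) * n)" for \<omega>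
    using record_gain_le[OF n, of "\<lambda>i. Z (Suc i) \<omega> - x / (2 * sqrt n)"]
      record_gain_nonneg[of n "\<lambda>i. Z (Suc i) \<omega> - x / (2 * sqrt n)"]
    unfolding sum ladder_increment_def
    by (cases "x * sqrt n < walk n \<omega>") simp_all
  then show "AE \<omega> in M. norm (ladder_increment x n \<omega>) \<le> norm (walk n \<omega> - x / (2 * sqrt n) * n)"
    by (intro AE_I2)
qed

lemma expectation_peak_le:
  assumes "0 \<le> x"
  shows "expectation (peak x N) \<le> sqrt N * (std_normal_density x + normal_loss x)"
proof -
  let ?c = "std_normal_density x + normal_loss x"
  have "expectation (peak x N) \<le> (\<Sum>n=1..N. ?c / (2 * sqrt (real n)))"
  proof (induction N)
    case 0
    show ?case by (simp add: peak_0)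
  next
    case (Suc N)
    have "expectation (peak x (Suc N)) - expectation (peak x N)
        = expectation (\<lambda>\<omega>. peak x (Suc N) \<omega> - peak x N \<omega>)"
      by (simp add: integrable_peak)
    also have "\<dots> \<le> expectation (ladder_increment x (Suc N))"
      by (intro integral_mono Bochner_Integration.integrable_diff integrable_peak
          integrable_ladder_increment peak_increment_le assms) simp
    also have "\<dots> = ?c / (2 * sqrt (Suc N))"
      using expectation_ladder_increment[OF assms, of "Suc N"] by simp
    finally show ?case using Suc by simp
  qed
  also have "\<dots> = ?c * (\<Sum>n=1..N. 1 / (2 * sqrt (real n)))"
    by (simp add: sum_distrib_left)
  also have "\<dots> \<le> ?c * sqrt N"
    by (intro mult_left_mono sum_inverse_sqrt_le add_nonneg_nonneg normal_loss_nonneg) simp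
  finally show ?thesis by (simp add: mult.commute)
qed

lemma expectation_peak_driftless:
  "expectation (peak 0 N) = std_normal_density 0 * (\<Sum>n=1..N. 1 / sqrt (real n))"
proof (induction N)
  case 0
  show ?case by (simp add: peak_0)
next
  case (Suc N)
  have "expectation (peak 0 (Suc N)) - expectation (peak 0 N)
      = expectation (\<lambda>\<omega>. peak 0 (Suc N) \<omega> - peak 0 N \<omega>)"
    by (simp add: integrable_peak)
  also have "\<dots> = std_normal_density 0 / sqrt (Suc N)"
    using expectation_ladder_increment[of 0 "Suc N"]
    unfolding peak_increment_driftless by (simp add: normal_loss_0)
  finally show ?case using Suc by (simp add: algebra_simps)
qed

lemma integrable_running_max: "integrable M (running_max Z \<sigma> \<kappa> \<alpha> N)"
  unfolding running_max_def[abs_def]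
proof (intro integrable_MAX)
  fix j
  show "integrable M (\<lambda>\<omega>. drifted_walk Z \<sigma> \<kappa> \<alpha> j \<omega>)"
    using integrable_walk[of j] by (cases "j = 0") (simp_all add: drifted_walk_def walk_def[abs_def])
qed auto

lemma running_max_ge: "j \<le> N \<Longrightarrow> drifted_walk Z \<sigma> \<kappa> \<alpha> j \<omega> \<le> running_max Z \<sigma> \<kappa> \<alpha> N \<omega>"
  unfolding running_max_def by (intro Max_ge) auto

section \<open>Bounds for the expected running maximum\<close>

lemma expectation_running_max_le:
  assumes "0 < \<sigma>" "0 < \<kappa>" "\<alpha> \<le> 1/2" and N: "1 \<le> N"
  defines "x \<equiv> \<kappa> * (real N powr \<alpha> / real N) * sqrt (real N)"
  shows "expectation (running_max Z \<sigma> \<kappa> \<alpha> N) \<le> \<sigma> * sqrt N * (std_normal_density x + normal_loss x)"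
proof -
  have x0: "0 \<le> x" using assms by simp
  have boundary: "x * sqrt j \<le> \<kappa> * real j powr \<alpha>" if "1 \<le> j" "j \<le> N" for j :: nat
  proof -
    have "real N powr \<alpha> / real N * sqrt N = real N powr (\<alpha> - 1/2)"
      using N powr_half_sqrt[of "real N"]
      by (simp only: powr_diff) (simp add: divide_simps)
    also have "\<dots> \<le> real j powr (\<alpha> - 1/2)"
      using assms that by (intro powr_mono2') auto
    finally have "x * sqrt j \<le> \<kappa> * (real j powr (\<alpha> - 1/2) * sqrt j)"
      using \<open>0 < \<kappa>\<close> unfolding x_def mult.assoc[of \<kappa>]
      by (intro mult_left_mono mult_right_mono) auto
    also have "real j powr (\<alpha> - 1/2) * sqrt j = real j powr \<alpha>"
      using that powr_half_sqrt[of "real j"] by (simp only: powr_diff) simp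
    finally show ?thesis .
  qed
  have "running_max Z \<sigma> \<kappa> \<alpha> N \<omega> \<le> \<sigma> * peak x N \<omega>" for \<omega>
  proof -
    have "drifted_walk Z \<sigma> \<kappa> \<alpha> j \<omega> \<le> \<sigma> * peak x N \<omega>" if "j \<le> N" for j
    proof (cases "j = 0")
      case True
      then show ?thesis using \<open>0 < \<sigma>\<close> peak_nonneg[of x N \<omega>] by (simp add: drifted_walk_def)
    next
      case False
      then have "drifted_walk Z \<sigma> \<kappa> \<alpha> j \<omega> = \<sigma> * (walk j \<omega> - \<kappa> * real j powr \<alpha>)"
        by (simp add: drifted_walk_def walk_def algebra_simps)
      also have "\<dots> \<le> \<sigma> * (walk j \<omega> - x * sqrt j)"
        using boundary[of j] False that \<open>0 < \<sigma>\<close> by (intro mult_left_mono) auto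
      also have "\<dots> \<le> \<sigma> * peak x N \<omega>"
        using peak_ge[OF that] \<open>0 < \<sigma>\<close> by (intro mult_left_mono) auto
      finally show ?thesis .
    qed
    then show ?thesis unfolding running_max_def by (subst Max_le_iff) auto
  qed
  then have "expectation (running_max Z \<sigma> \<kappa> \<alpha> N) \<le> expectation (\<lambda>\<omega>. \<sigma> * peak x N \<omega>)"
    by (intro integral_mono integrable_running_max integrable_mult_right integrable_peak)
  also have "\<dots> \<le> \<sigma> * (sqrt N * (std_normal_density x + normal_loss x))"
    using expectation_peak_le[OF x0] \<open>0 < \<sigma>\<close> by simp
  finally show ?thesis by (simp add: mult.assoc)
qed

lemma expectation_running_max_ge_last:
  assumes "0 < \<sigma>" "1 \<le> N"
  shows "\<sigma> * normal_loss \<kappa> * sqrt N \<le> expectation (running_max Z \<sigma> \<kappa> (1/2) N)"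
proof -
  have "\<sigma> * normal_loss \<kappa> * sqrt N = (\<integral>u. \<sigma> * sqrt N * max (u - \<kappa>) 0 \<partial>std_normal_measure)"
    by (simp add: normal_loss_def)
  also have "\<dots> = expectation (\<lambda>\<omega>. \<sigma> * sqrt N * max ((\<Sum>i=1..N. Z i \<omega>) / sqrt N - \<kappa>) 0)"
    by (subst expectation_normalized_sum[OF assms(2), of "\<lambda>u. \<sigma> * sqrt N * max (u - \<kappa>) 0"]) auto
  also have "\<dots> \<le> expectation (running_max Z \<sigma> \<kappa> (1/2) N)"
  proof (intro integral_mono integrable_running_max)
    show "integrable M (\<lambda>\<omega>. \<sigma> * sqrt N * max ((\<Sum>i=1..N. Z i \<omega>) / sqrt N - \<kappa>) 0)"
      using integrable_walk[of N] by (simp add: walk_def[abs_def])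
    fix \<omega>
    have eq: "\<sigma> * sqrt N * ((\<Sum>i=1..N. Z i \<omega>) / sqrt N - \<kappa>) = drifted_walk Z \<sigma> \<kappa> (1/2) N \<omega>"
      using assms by (simp add: drifted_walk_def powr_half_sqrt field_simps)
    have "0 = drifted_walk Z \<sigma> \<kappa> (1/2) 0 \<omega>" by (simp add: drifted_walk_def)
    also have "\<dots> \<le> running_max Z \<sigma> \<kappa> (1/2) N \<omega>" by (rule running_max_ge) simp
    finally show "\<sigma> * sqrt N * max ((\<Sum>i=1..N. Z i \<omega>) / sqrt N - \<kappa>) 0 \<le> running_max Z \<sigma> \<kappa> (1/2) N \<omega>"
      using running_max_ge[of N N \<sigma> \<kappa> "1/2" \<omega>] unfolding eq[symmetric] by (auto simp: max_def)
  qed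
  finally show ?thesis .
qed

text \<open>
  Up to time \<open>N\<close> the drift is at most its final value, so the maximum of the walk without drift is
  reduced by no more than that value.
\<close>
lemma expectation_running_max_ge_driftless:
  assumes "0 < \<sigma>" "0 < \<kappa>" "0 \<le> \<alpha>"
  shows "\<sigma> * (std_normal_density 0 * (2 * sqrt (real N + 1) - 2) - \<kappa> * real N powr \<alpha>)
    \<le> expectation (running_max Z \<sigma> \<kappa> \<alpha> N)"
proof -
  have "\<sigma> * (std_normal_density 0 * (2 * sqrt (real N + 1) - 2) - \<kappa> * real N powr \<alpha>)
      \<le> \<sigma> * (expectation (peak 0 N) - \<kappa> * real N powr \<alpha>)"
    unfolding expectation_peak_driftless using assms
    by (intro mult_left_mono diff_right_mono sum_inverse_sqrt_ge) auto
  also have "\<dots> = expectation (\<lambda>\<omega>. \<sigma> * (peak 0 N \<omega> - \<kappa> * real N powr \<alpha>))"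
    by (simp add: integrable_peak prob_space)
  also have "\<dots> \<le> expectation (running_max Z \<sigma> \<kappa> \<alpha> N)"
  proof (intro integral_mono integrable_running_max)
    show "integrable M (\<lambda>\<omega>. \<sigma> * (peak 0 N \<omega> - \<kappa> * real N powr \<alpha>))"
      by (simp add: integrable_peak)
    fix \<omega>
    have "peak 0 N \<omega> \<in> (\<lambda>j. walk j \<omega> - 0 * sqrt (real j)) ` {..N}"
      unfolding peak_def by (intro Max_in) auto
    then obtain j where j: "j \<le> N" "peak 0 N \<omega> = walk j \<omega>" by auto
    have "real j powr \<alpha> \<le> real N powr \<alpha>" using j assms by (intro powr_mono2) auto
    then have "\<sigma> * (walk j \<omega> - \<kappa> * real N powr \<alpha>) \<le> \<sigma> * (walk j \<omega> - \<kappa> * real j powr \<alpha>)"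
      using assms by simp
    also have "\<dots> \<le> drifted_walk Z \<sigma> \<kappa> \<alpha> j \<omega>"
      using assms by (simp add: drifted_walk_def walk_def algebra_simps)
    also have "\<dots> \<le> running_max Z \<sigma> \<kappa> \<alpha> N \<omega>" by (rule running_max_ge[OF j(1)])
    finally show "\<sigma> * (peak 0 N \<omega> - \<kappa> * real N powr \<alpha>) \<le> running_max Z \<sigma> \<kappa> \<alpha> N \<omega>"
      using j by simp
  qed
  finally show ?thesis .
qed

end

text \<open>
  After division by \<open>\<surd>N\<close>, the constant and the drift are negligible against the surplus \<open>a\<close>
  that is left when the target \<open>a \<surd>N\<close> is taken from \<open>2 a \<surd>N\<close>.
\<close>
lemma eventually_driftless_bound_dominates:
  fixes a :: real
  assumes "0 < a" "\<alpha> < 1/2"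
  shows "\<forall>\<^sub>F N in sequentially. a * sqrt (real N) \<le> a * (2 * sqrt (real N + 1) - 2) - \<kappa> * real N powr \<alpha>"
proof -
  have "(\<lambda>N::nat. 2 * a / sqrt (real N) + \<kappa> * real N powr (\<alpha> - 1/2)) \<longlonglongrightarrow> 0 + \<kappa> * 0"
  proof (intro tendsto_intros)
    show "(\<lambda>N::nat. 2 * a / sqrt (real N)) \<longlonglongrightarrow> 0"
      by real_asymp
    show "(\<lambda>N::nat. real N powr (\<alpha> - 1/2)) \<longlonglongrightarrow> 0"
      using assms by (intro tendsto_neg_powr filterlim_real_sequentially) simp
  qed
  then have "\<forall>\<^sub>F N::nat in sequentially. 2 * a / sqrt (real N) + \<kappa> * real N powr (\<alpha> - 1/2) < a"
    using assms by (intro order_tendstoD(2)) auto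
  then show ?thesis
    using eventually_gt_at_top[of 0]
  proof eventually_elim
    case (elim N)
    then have "2 * a + \<kappa> * real N powr \<alpha> \<le> a * sqrt (real N)"
      using powr_half_sqrt[of "real N"]
      by (simp only: powr_diff) (simp add: divide_simps split: if_splits)
    moreover have "a * sqrt (real N) \<le> a * sqrt (real N + 1)" using assms by simp
    ultimately show ?case by (simp add: algebra_simps)
  qed
qed

theorem proposition4:
  fixes M :: "'a measure" and Z :: "nat \<Rightarrow> 'a \<Rightarrow> real" and \<sigma> \<kappa> \<alpha> :: real
  assumes "prob_space M"
    and "0 < \<sigma>" and "0 \<le> \<alpha>" and "\<alpha> \<le> 1/2" and "0 < \<kappa>"
    and "prob_space.indep_vars M (\<lambda>_. borel) Z {1..}"
    and "\<And>i. 1 \<le> i \<Longrightarrow> distributed M lborel (Z i) std_normal_density"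
  defines "EL \<equiv> \<lambda>N::nat. prob_space.expectation M (running_max Z \<sigma> \<kappa> \<alpha> N)"
    and "\<Theta> \<equiv> \<lambda>N::nat. real N powr \<alpha> / real N"
  shows "(\<exists>c1 c2. 0 < c1 \<and> c1 \<le> c2 \<and>
            (\<forall>\<^sub>F N in sequentially. c1 * sqrt (real N) \<le> EL N \<and> EL N \<le> c2 * sqrt (real N))) \<and>
         (\<alpha> = 1/2 \<longrightarrow> (\<forall>\<^sub>F N in sequentially. EL N \<ge> \<sigma> * normal_loss \<kappa> * sqrt (real N))) \<and>
         (\<alpha> < 1/2 \<longrightarrow> (\<forall>\<^sub>F N in sequentially. EL N \<ge> \<sigma> * normal_loss 0 * sqrt (real N))) \<and>
         (\<forall>N\<ge>1.
            EL N \<le> \<sigma> * sqrt (real N) *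
                (std_normal_density (\<kappa> * \<Theta> N * sqrt (real N)) + normal_loss (\<kappa> * \<Theta> N * sqrt (real N))) \<and>
            \<sigma> * sqrt (real N) *
                (std_normal_density (\<kappa> * \<Theta> N * sqrt (real N)) + normal_loss (\<kappa> * \<Theta> N * sqrt (real N)))
              \<le> \<sigma> * sqrt (real N) * (std_normal_density 0 + normal_loss 0) \<and>
            \<sigma> * sqrt (real N) * (std_normal_density 0 + normal_loss 0)
              = 2 * \<sigma> * std_normal_density 0 * sqrt (real N))"
proof -
  interpret std_normal_sequence M Z
    using assms by (intro std_normal_sequence.intro std_normal_sequence_axioms.intro) auto
  have \<sigma>: "0 < \<sigma>" and \<alpha>: "0 \<le> \<alpha>" "\<alpha> \<le> 1/2" and \<kappa>: "0 < \<kappa>" by fact+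
  define x where "x N = \<kappa> * \<Theta> N * sqrt (real N)" for N :: nat
  let ?b = "\<lambda>t. std_normal_density t + normal_loss t"
  have upper: "EL N \<le> \<sigma> * sqrt (real N) * ?b (x N)" if "1 \<le> N" for N
    using expectation_running_max_le[OF \<sigma> \<kappa> \<alpha>(2) that] by (simp add: EL_def x_def \<Theta>_def)
  have upper_0: "\<sigma> * sqrt (real N) * ?b (x N) \<le> \<sigma> * sqrt (real N) * ?b 0" for N
  proof -
    have "0 \<le> x N" using \<kappa> by (simp add: x_def \<Theta>_def)
    then show ?thesis
      using \<sigma> by (intro mult_left_mono add_mono std_normal_density_le_0 normal_loss_antimono) auto
  qed
  have at_0: "\<sigma> * sqrt (real N) * ?b 0 = 2 * \<sigma> * std_normal_density 0 * sqrt (real N)" for N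
    by (simp add: normal_loss_0)
  have lower_half: "\<forall>\<^sub>F N in sequentially. EL N \<ge> \<sigma> * normal_loss \<kappa> * sqrt (real N)" if "\<alpha> = 1/2"
    using eventually_ge_at_top[of 1]
    unfolding EL_def that by eventually_elim (rule expectation_running_max_ge_last[OF \<sigma>])
  have lower_less: "\<forall>\<^sub>F N in sequentially. EL N \<ge> \<sigma> * normal_loss 0 * sqrt (real N)" if "\<alpha> < 1/2"
  proof -
    have "0 < std_normal_density 0" by (simp add: normal_density_pos)
    from eventually_driftless_bound_dominates[OF this that, of \<kappa>] show ?thesis
    proof eventually_elim
      case (elim N)
      from mult_left_mono[OF this, of \<sigma>] \<sigma>
      have "\<sigma> * normal_loss 0 * sqrt (real N)
          \<le> \<sigma> * (std_normal_density 0 * (2 * sqrt (real N + 1) - 2) - \<kappa> * real N powr \<alpha>)"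
        by (simp add: normal_loss_0 mult.assoc)
      also have "\<dots> \<le> EL N"
        using expectation_running_max_ge_driftless[OF \<sigma> \<kappa> \<alpha>(1)] by (simp add: EL_def)
      finally show ?case .
    qed
  qed
  have order: "\<exists>c1 c2. 0 < c1 \<and> c1 \<le> c2 \<and>
      (\<forall>\<^sub>F N in sequentially. c1 * sqrt (real N) \<le> EL N \<and> EL N \<le> c2 * sqrt (real N))"
  proof -
    (* As 0 < \<kappa>, the constant for the square root boundary serves for smaller exponents too. *)
    have ev: "\<forall>\<^sub>F N in sequentially. EL N \<ge> \<sigma> * normal_loss \<kappa> * sqrt (real N)"
    proof (cases "\<alpha> = 1/2")
      case False
      then have "\<alpha> < 1/2" using \<alpha> by simp
      have "\<sigma> * normal_loss \<kappa> * sqrt (real N) \<le> \<sigma> * normal_loss 0 * sqrt (real N)" for N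
        using \<sigma> \<kappa> normal_loss_antimono[of 0 \<kappa>] by (intro mult_right_mono mult_left_mono) auto
      with lower_less[OF \<open>\<alpha> < 1/2\<close>] show ?thesis
        by (auto elim!: eventually_mono intro: order_trans)
    qed (rule lower_half)
    have le: "\<sigma> * normal_loss \<kappa> \<le> \<sigma> * ?b 0"
      using \<sigma> \<kappa> normal_loss_antimono[of 0 \<kappa>]
      by (intro mult_left_mono) (auto intro!: add_increasing)
    have "\<forall>\<^sub>F N in sequentially. EL N \<le> \<sigma> * ?b 0 * sqrt (real N)"
      using eventually_ge_at_top[of 1]
    proof eventually_elim
      case (elim N)
      from order_trans[OF upper[OF this] upper_0] show ?case by (simp add: mult_ac)
    qed
    with ev have "\<forall>\<^sub>F N in sequentially. \<sigma> * normal_loss \<kappa> * sqrt (real N) \<le> EL N \<and>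
        EL N \<le> \<sigma> * ?b 0 * sqrt (real N)"
      by (rule eventually_conj)
    then show ?thesis
      using le \<sigma> normal_loss_pos[of \<kappa>] by (intro exI[of _ "\<sigma> * normal_loss \<kappa>"] exI[of _ "\<sigma> * ?b 0"]) simp
  qed
  show ?thesis
    using order lower_half lower_less upper upper_0 at_0 unfolding x_def by blast
qed

end
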